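(* Let $\mathbf{A}=[a_{ij}]$ be an $n\times n$ pairwise comparison matrix and let $\mathbf{w}=(w_1,\dots,w_n)^{\top}$ be a positive weight vector. Then $\mathbf{w}$ is efficient with respect to $\mathbf{A}$ if and only if it is internally efficient with respect to $\mathbf{A}$.
   Context: A pairwise comparison matrix of size $n\times n$ ($n\ge 3$) is a real matrix $\mathbf{A}=[a_{ij}]$ with all entries positive and $a_{ij}=1/a_{ji}$ for all $1\le i,j\le n$. A positive weight vector $\mathbf{w}$ is called efficient (with respect to $\mathbf{A}$) if there is no positive vector $\mathbf{w}'$ such that $|a_{ij}-w'_i/w'_j|\le|a_{ij}-w_i/w_j|$ for all $1\le i,j\le n$ and $|a_{k\ell}-w'_k/w'_\ell|<|a_{k\ell}-w_k/w_\ell|$ for some $1\le k,\ell\le n$. A positive weight vector $\mathbf{w}$ is called internally efficient (with respect to $\mathbf{A}$) if there is no positive vector $\mathbf{w}'$ such that (i) for all $1\le i,j\le n$: $a_{ij}\le w_i/w_j$ implies $a_{ij}\le w'_i/w'_j\le w_i/w_j$, and $a_{ij}\ge w_i/w_j$ implies $a_{ij}\ge w'_i/w'_j\ge w_i/w_j$; and (ii) for some $1\le k,\ell\le n$ both implications hold: $a_{k\ell}\le w_k/w_\ell$ implies $w'_k/w'_\ell<w_k/w_\ell$, and $a_{k\ell}\ge w_k/w_\ell$ implies $w'_k/w'_\ell>w_k/w_\ell$. *)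

theory Defs
  imports "HOL-Analysis.Analysis"
begin

definition pairwise_comparison_matrix :: "real ^ 'n ^ 'n \<Rightarrow> bool" where
  "pairwise_comparison_matrix A \<longleftrightarrow>
     CARD('n) \<ge> 3 \<and> (\<forall>i j. A $ i $ j > 0) \<and> (\<forall>i j. A $ i $ j = 1 / A $ j $ i)"

definition positive_vector :: "real ^ 'n \<Rightarrow> bool" where
  "positive_vector w \<longleftrightarrow> (\<forall>i. w $ i > 0)"

definition efficient :: "real ^ 'n ^ 'n \<Rightarrow> real ^ 'n \<Rightarrow> bool" where
  "efficient A w \<longleftrightarrow> positive_vector w \<and>
     \<not> (\<exists>w'. positive_vector w' \<and>
          (\<forall>i j. \<bar>A $ i $ j - w' $ i / w' $ j\<bar> \<le> \<bar>A $ i $ j - w $ i / w $ j\<bar>) \<and>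
          (\<exists>k l. \<bar>A $ k $ l - w' $ k / w' $ l\<bar> < \<bar>A $ k $ l - w $ k / w $ l\<bar>))"

definition internally_efficient :: "real ^ 'n ^ 'n \<Rightarrow> real ^ 'n \<Rightarrow> bool" where
  "internally_efficient A w \<longleftrightarrow> positive_vector w \<and>
     \<not> (\<exists>w'. positive_vector w' \<and>
          (\<forall>i j.
             (A $ i $ j \<le> w $ i / w $ j \<longrightarrow>
                A $ i $ j \<le> w' $ i / w' $ j \<and> w' $ i / w' $ j \<le> w $ i / w $ j) \<and>
             (A $ i $ j \<ge> w $ i / w $ j \<longrightarrow>
                A $ i $ j \<ge> w' $ i / w' $ j \<and> w' $ i / w' $ j \<ge> w $ i / w $ j)) \<and>
          (\<exists>k l.
             (A $ k $ l \<le> w $ k / w $ l \<longrightarrow> w' $ k / w' $ l < w $ k / w $ l) \<and>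
             (A $ k $ l \<ge> w $ k / w $ l \<longrightarrow> w' $ k / w' $ l > w $ k / w $ l)))"

end

theory Submission
  imports Defs
begin

text \<open>
  An internal improvement is an improvement, so efficiency implies internal efficiency.
  Conversely, if \<open>w'\<close> improves on \<open>w\<close>, then every ratio of \<open>w'\<close> lies weakly on the same side
  of the corresponding ratio of \<open>w\<close> as the entry of the matrix does, though it may overshoot
  that entry. The ratios of \<open>(1 - t) w + t w'\<close> are mediants of those of \<open>w\<close> and \<open>w'\<close>, so they move
  in the same direction, and for small \<open>t > 0\<close> they do not overshoot: this vector is an internal
  improvement.
\<close>

text \<open>Clearing the positive denominators leaves the summand \<open>(1 - t) * p * q\<close> on
  both sides. It cancels, and what remains carries the common factor \<open>t > 0\<close>, so the
  direction of movement does not depend on \<open>t\<close>.\<close>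

lemma mediant_less_iff:
  fixes p q u v t :: real
  assumes "p > 0" "q > 0" "u > 0" "v > 0" "0 < t" "t < 1"
  shows "((1 - t) * p + t * u) / ((1 - t) * q + t * v) < p / q \<longleftrightarrow> u / v < p / q"
proof -
  have "(1 - t) * q + t * v > 0"
    using assms by (simp add: add_pos_pos)
  then have "((1 - t) * p + t * u) / ((1 - t) * q + t * v) < p / q \<longleftrightarrow>
      ((1 - t) * p + t * u) * q < p * ((1 - t) * q + t * v)"
    using assms by (simp add: divide_simps mult.commute)
  also have "\<dots> \<longleftrightarrow> t * (u * q) < t * (p * v)"
    by (simp add: algebra_simps)
  also have "\<dots> \<longleftrightarrow> u / v < p / q"
    using assms by (simp add: divide_simps mult.commute)
  finally show ?thesis .
qed

text \<open>The mirror image of \<open>mediant_less_iff\<close>, by the same cancellation. The two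
  together also settle equality: the mediant equals \<open>p / q\<close> exactly when
  \<open>u / v\<close> does.\<close>

lemma mediant_greater_iff:
  fixes p q u v t :: real
  assumes "p > 0" "q > 0" "u > 0" "v > 0" "0 < t" "t < 1"
  shows "p / q < ((1 - t) * p + t * u) / ((1 - t) * q + t * v) \<longleftrightarrow> p / q < u / v"
proof -
  have "(1 - t) * q + t * v > 0"
    using assms by (simp add: add_pos_pos)
  then have "p / q < ((1 - t) * p + t * u) / ((1 - t) * q + t * v) \<longleftrightarrow>
      p * ((1 - t) * q + t * v) < ((1 - t) * p + t * u) * q"
    using assms by (simp add: divide_simps mult.commute)
  also have "\<dots> \<longleftrightarrow> t * (p * v) < t * (u * q)"
    by (simp add: algebra_simps)
  also have "\<dots> \<longleftrightarrow> p / q < u / v"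
    using assms by (simp add: divide_simps mult.commute)
  finally show ?thesis .
qed

text \<open>The mediant is continuous in \<open>t\<close> at 0 with value \<open>p / q\<close>, and
  a strict inequality at the limit persists nearby. The case \<open>a = p / q\<close> gives no such
  margin and is left to the two equivalences above.\<close>

lemma eventually_mediant_no_overshoot:
  fixes a p q u v :: real
  assumes "q > 0"
  shows "\<forall>\<^sub>F t in at_right 0.
    (a < p / q \<longrightarrow> a < ((1 - t) * p + t * u) / ((1 - t) * q + t * v)) \<and>
    (p / q < a \<longrightarrow> ((1 - t) * p + t * u) / ((1 - t) * q + t * v) < a)"
proof -
  \<comment> \<open>The limit stays unsimplified, with 0 in place of \<open>t\<close>, so that it
    has the shape produced by the limit rules.\<close>
  have "((\<lambda>t. ((1 - t) * p + t * u) / ((1 - t) * q + t * v)) \<longlongrightarrow>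
      ((1 - 0) * p + 0 * u) / ((1 - 0) * q + 0 * v)) (at_right 0)"
    using assms by (intro tendsto_intros) auto
  then have lim: "((\<lambda>t. ((1 - t) * p + t * u) / ((1 - t) * q + t * v)) \<longlongrightarrow> p / q) (at_right 0)"
    by simp
  show ?thesis
    by (intro eventually_conj)
      (cases "a < p / q"; cases "p / q < a"; auto dest: order_tendstoD[OF lim])+
qed

theorem proposition1p1:
  fixes A :: "real ^ 'n ^ 'n" and w :: "real ^ 'n"
  assumes "pairwise_comparison_matrix A"
    and "positive_vector w"
  shows "efficient A w \<longleftrightarrow> internally_efficient A w"
proof
  assume eff: "efficient A w"
  show "internally_efficient A w"
    unfolding internally_efficient_def
  proof (intro conjI notI)
    show "positive_vector w" by fact
    assume "\<exists>w'. positive_vector w' \<and>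
          (\<forall>i j.
             (A $ i $ j \<le> w $ i / w $ j \<longrightarrow>
                A $ i $ j \<le> w' $ i / w' $ j \<and> w' $ i / w' $ j \<le> w $ i / w $ j) \<and>
             (A $ i $ j \<ge> w $ i / w $ j \<longrightarrow>
                A $ i $ j \<ge> w' $ i / w' $ j \<and> w' $ i / w' $ j \<ge> w $ i / w $ j)) \<and>
          (\<exists>k l.
             (A $ k $ l \<le> w $ k / w $ l \<longrightarrow> w' $ k / w' $ l < w $ k / w $ l) \<and>
             (A $ k $ l \<ge> w $ k / w $ l \<longrightarrow> w' $ k / w' $ l > w $ k / w $ l))"
    then obtain w' k l where pos: "positive_vector w'"
      and weak: "\<And>i j.
             (A $ i $ j \<le> w $ i / w $ j \<longrightarrow>
                A $ i $ j \<le> w' $ i / w' $ j \<and> w' $ i / w' $ j \<le> w $ i / w $ j) \<and>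
             (A $ i $ j \<ge> w $ i / w $ j \<longrightarrow>
                A $ i $ j \<ge> w' $ i / w' $ j \<and> w' $ i / w' $ j \<ge> w $ i / w $ j)"
      and strict: "A $ k $ l \<le> w $ k / w $ l \<longrightarrow> w' $ k / w' $ l < w $ k / w $ l"
        "A $ k $ l \<ge> w $ k / w $ l \<longrightarrow> w' $ k / w' $ l > w $ k / w $ l"
      by blast
    have "\<bar>A $ i $ j - w' $ i / w' $ j\<bar> \<le> \<bar>A $ i $ j - w $ i / w $ j\<bar>" for i j
      using weak[of i j] by linarith
    \<comment> \<open>Equality of \<open>A $ k $ l\<close> and \<open>w $ k / w $ l\<close> is
      excluded: both implications in \<open>strict\<close> would fire and contradict each
      other.\<close>
    moreover have "\<bar>A $ k $ l - w' $ k / w' $ l\<bar> < \<bar>A $ k $ l - w $ k / w $ l\<bar>"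
      using weak[of k l] strict by linarith
    ultimately show False
      using eff pos unfolding efficient_def by blast
  qed
next
  assume int: "internally_efficient A w"
  show "efficient A w"
    unfolding efficient_def
  proof (intro conjI notI)
    show "positive_vector w" by fact
    assume "\<exists>w'. positive_vector w' \<and>
          (\<forall>i j. \<bar>A $ i $ j - w' $ i / w' $ j\<bar> \<le> \<bar>A $ i $ j - w $ i / w $ j\<bar>) \<and>
          (\<exists>k l. \<bar>A $ k $ l - w' $ k / w' $ l\<bar> < \<bar>A $ k $ l - w $ k / w $ l\<bar>)"
    then obtain w' k l where pos: "positive_vector w'"
      and weak: "\<And>i j. \<bar>A $ i $ j - w' $ i / w' $ j\<bar> \<le> \<bar>A $ i $ j - w $ i / w $ j\<bar>"
      and strict: "\<bar>A $ k $ l - w' $ k / w' $ l\<bar> < \<bar>A $ k $ l - w $ k / w $ l\<bar>"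
      by blast
    define m where "m t = (1 - t) *\<^sub>R w + t *\<^sub>R w'" for t
    have wpos: "w $ i > 0" "w' $ i > 0" for i
      using assms(2) pos by (auto simp: positive_vector_def)
    have "\<forall>\<^sub>F t in at_right 0. t < 1 \<and> 0 < t \<and> (\<forall>i j.
        (A $ i $ j < w $ i / w $ j \<longrightarrow> A $ i $ j < m t $ i / m t $ j) \<and>
        (w $ i / w $ j < A $ i $ j \<longrightarrow> m t $ i / m t $ j < A $ i $ j))"
    \<comment> \<open>There are only finitely many index pairs, so a single small \<open>t\<close>
      serves all of them.\<close>
    proof (rule eventually_conj[OF _ eventually_conj[OF _ eventually_all_finite[OF eventually_all_finite]]])
      show "\<forall>\<^sub>F t in at_right (0::real). t < 1"
        by (rule order_tendstoD(2)[OF tendsto_ident_at]) simp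
      show "\<forall>\<^sub>F t in at_right (0::real). 0 < t"
        by (rule eventually_at_right_less)
      show "\<forall>\<^sub>F t in at_right 0.
          (A $ i $ j < w $ i / w $ j \<longrightarrow> A $ i $ j < m t $ i / m t $ j) \<and>
          (w $ i / w $ j < A $ i $ j \<longrightarrow> m t $ i / m t $ j < A $ i $ j)" for i j
        using eventually_mediant_no_overshoot[OF wpos(1)] by (simp add: m_def)
    qed
    from eventually_happens'[OF trivial_limit_at_right_real this] obtain t where t: "0 < t" "t < 1"
      and no_overshoot: "\<And>i j. A $ i $ j < w $ i / w $ j \<Longrightarrow> A $ i $ j < m t $ i / m t $ j"
        "\<And>i j. w $ i / w $ j < A $ i $ j \<Longrightarrow> m t $ i / m t $ j < A $ i $ j"
      by blast
    have less: "m t $ i / m t $ j < w $ i / w $ j \<longleftrightarrow> w' $ i / w' $ j < w $ i / w $ j"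
      and greater: "w $ i / w $ j < m t $ i / m t $ j \<longleftrightarrow> w $ i / w $ j < w' $ i / w' $ j" for i j
      using mediant_less_iff[OF wpos(1) wpos(1) wpos(2) wpos(2) t]
        mediant_greater_iff[OF wpos(1) wpos(1) wpos(2) wpos(2) t]
      by (auto simp: m_def)
    have "positive_vector (m t)"
      using wpos t by (simp add: positive_vector_def m_def add_pos_pos)
    \<comment> \<open>A ratio of \<open>w'\<close> moving away from the entry would increase the
      error, so \<open>less\<close> and \<open>greater\<close> rule out the wrong direction for
      \<open>m t\<close>. If the entry equals the ratio of \<open>w\<close>, the error is 0 and the
      ratio stays fixed.\<close>
    moreover have "(A $ i $ j \<le> w $ i / w $ j \<longrightarrow>
          A $ i $ j \<le> m t $ i / m t $ j \<and> m t $ i / m t $ j \<le> w $ i / w $ j) \<and>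
        (A $ i $ j \<ge> w $ i / w $ j \<longrightarrow>
          A $ i $ j \<ge> m t $ i / m t $ j \<and> m t $ i / m t $ j \<ge> w $ i / w $ j)" for i j
      using no_overshoot[of i j] less[of i j] greater[of i j] weak[of i j] by linarith
    \<comment> \<open>The strict decrease forces a positive error of \<open>w\<close> at
      \<open>k\<close>, \<open>l\<close>, so exactly one premise holds, and there the ratio of
      \<open>w'\<close> moves strictly towards the entry.\<close>
    moreover have "(A $ k $ l \<le> w $ k / w $ l \<longrightarrow> m t $ k / m t $ l < w $ k / w $ l) \<and>
        (A $ k $ l \<ge> w $ k / w $ l \<longrightarrow> m t $ k / m t $ l > w $ k / w $ l)"
      using less[of k l] greater[of k l] strict by linarith
    ultimately have "\<not> internally_efficient A w"
      unfolding internally_efficient_def not_not de_Morgan_conj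
      by (intro disjI2 exI[of _ "m t"] conjI[OF _ conjI] allI exI[of _ k] exI[of _ l])
    with int show False
      by contradiction
  qed
qed

end
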